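(* Let $q\geq 2$ be a prime power and $n$ a positive integer with $n\not\equiv 0\pmod 3$. Let $\omega\in\mathbb{F}_{q^{2n}}\setminus\mathbb{F}_{q^n}$, let $a\in\mathbb{F}_{q^{3n}}^*$ and let $i$ be an integer with $1\leq i\leq 3n-1$ such that (i) $\gcd(i,2n)=1$ and $\gcd(i,3n)=3$, and (ii) $N_{q^{3n}/q^3}(a)\notin\mathbb{F}_q$. Then $$L_U=\{\langle ax^{q^i}+x\omega\rangle_{\mathbb{F}_{q^{2n}}} : x\in\mathbb{F}_{q^{3n}}^*\},\qquad U=\{ax^{q^i}+x\omega: x\in\mathbb{F}_{q^{3n}}\},$$ is a scattered $\mathbb{F}_q$-linear set of rank $3n$ of the projective plane $PG(2,q^{2n})=PG(\mathbb{F}_{q^{6n}},\mathbb{F}_{q^{2n}})$.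
   Context: $N_{q^{3n}/q^3}$ denotes the norm map from $\mathbb{F}_{q^{3n}}$ to $\mathbb{F}_{q^3}$. $\mathbb{F}_{q^{6n}}$ is regarded as a $3$-dimensional vector space over $\mathbb{F}_{q^{2n}}$. For an $\mathbb{F}_q$-subspace $U$ of $\mathbb{F}_{q^{6n}}$ of $\mathbb{F}_q$-dimension $k$, $L_U=\{\langle u\rangle_{\mathbb{F}_{q^{2n}}}: u\in U\setminus\{0\}\}$ is an $\mathbb{F}_q$-linear set of rank $k$; it is scattered if every point $\langle v\rangle$ of $L_U$ satisfies $\dim_{\mathbb{F}_q}(U\cap\langle v\rangle_{\mathbb{F}_{q^{2n}}})=1$. *)

theory Defs
  imports "HOL-Algebra.Embedded_Algebras" "HOL-Number_Theory.Prime_Powers" "HOL-Number_Theory.Cong"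
begin

text \<open>
  Throughout, the ambient vector space is a field \<open>R\<close> over one of its subfields \<open>K\<close>; the library
  predicate \<^const>\<open>subalgebra\<close> \<open>K V R\<close> says exactly that \<open>V\<close> is a \<open>K\<close>-linear subspace of \<open>R\<close>.
\<close>

text \<open>
  The norm from a finite subfield \<open>L\<close> to a subfield \<open>K\<close> of \<open>L\<close>: the product of the conjugates
  \<open>a, a^Q, a^(Q^2), ..., a^(Q^(d-1))\<close>, where \<open>Q = |K|\<close> and \<open>d = [L : K]\<close>.
\<close>
definition (in cring) finite_field_norm :: "'a set \<Rightarrow> 'a set \<Rightarrow> 'a \<Rightarrow> 'a" where
  "finite_field_norm L K a = (\<Otimes>j\<in>{..<dim K L}. a [^] (card K ^ j))"

context ring
begin

definition pg_points :: "'a set \<Rightarrow> 'a set \<Rightarrow> 'a set set" where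
  "pg_points K V = {P. subalgebra K P R \<and> P \<subseteq> V \<and> dimension 1 K P}"

definition linear_set :: "'a set \<Rightarrow> 'a set \<Rightarrow> 'a set set" where
  "linear_set K U = {Span K [u] | u. u \<in> U - {\<zero>}}"

text \<open>
  Here \<open>k\<close> is the smaller field (over which \<open>U\<close> is linear) and \<open>K\<close> the field over which points
  are formed.
\<close>
definition scattered :: "'a set \<Rightarrow> 'a set \<Rightarrow> 'a set \<Rightarrow> bool" where
  "scattered k K U \<longleftrightarrow> (\<forall>P\<in>linear_set K U. dimension 1 k (U \<inter> P))"

end

end

theory Submission
  imports Defs "HOL-Algebra.Multiplicative_Group"
begin

text \<open>
  Write \<open>\<sigma>\<close> for \<open>x \<mapsto> x^(q^i)\<close>. Two proportional vectors of \<open>U\<close>, with parameters \<open>y\<close> and \<open>x\<close> and factor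
  \<open>s + t\<omega>\<close> (\<open>s, t\<close> in \<open>F_(q^n)\<close>), are compared in the basis \<open>1, \<omega>\<close> of \<open>F_(q^(6n))\<close> over \<open>F_(q^(3n))\<close>.
  If \<open>t = 0\<close>, then \<open>y = s x\<close> and \<open>s\<close> is fixed by \<open>\<sigma>\<close>, so \<open>s\<close> lies in \<open>F_q\<close>. If \<open>t \<noteq> 0\<close>, then
  \<open>z = a x^\<sigma> / x\<close> satisfies \<open>z z^\<sigma> = A + C z\<close> with \<open>A, C\<close> in \<open>F_(q^n)\<close>. By the resulting two-term
  recurrence every partial product \<open>w_j = z z^\<sigma> ... z^(\<sigma>^(j-1))\<close> lies in the \<open>F_(q^n)\<close>-span of \<open>1, z\<close>.
  Now \<open>w_n\<close> is the norm of \<open>z\<close>, which equals the norm of \<open>a\<close>, and \<open>w_(n+1) = w_n z\<close> lies in the span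
  too. As \<open>z\<close> has degree 1 or 3 over \<open>F_(q^n)\<close>, this forces \<open>w_n\<close> into \<open>F_(q^n)\<close>, hence into
  \<open>F_(q^n) \<inter> F_(q^3) = F_q\<close>, against the hypothesis on \<open>a\<close>.
\<close>

section \<open>Additivity of the Frobenius power maps\<close>

lemma (in cring) binomial_theorem:
  assumes x: "x \<in> carrier R" and y: "y \<in> carrier R"
  shows "(x \<oplus> y) [^] (n::nat) = (\<Oplus>k\<in>{..n}. [(n choose k)] \<cdot> (x [^] k \<otimes> y [^] (n - k)))"
proof (induction n)
  case 0
  show ?case using x y by simp
next
  case (Suc n)
  \<comment> \<open>The exponent of \<open>y\<close> is an argument of its own, so that multiplying
    by \<open>y\<close> only raises it and no truncated subtraction interferes.\<close>
  define f where "f m k = [(n choose m)] \<cdot> (x [^] m \<otimes> y [^] (k::nat))" for m k :: nat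
  have f: "f m k \<in> carrier R" for m k
    using x y by (simp add: f_def)
  have fx: "x \<otimes> f m k = [(n choose m)] \<cdot> (x [^] Suc m \<otimes> y [^] k)" for m k
    using x y by (simp add: f_def add_pow_rdistr m_ac)
  have fy: "y \<otimes> f m k = f m (Suc k)" for m k
    using x y by (simp add: f_def add_pow_rdistr m_ac)
  \<comment> \<open>Pascal's rule splits the coefficient: the first summand belongs to
    \<open>x\<close> times the expansion for \<open>n\<close>, the second to \<open>y\<close> times
    it.\<close>
  have step: "[(Suc n choose Suc k)] \<cdot> (x [^] Suc k \<otimes> y [^] (Suc n - Suc k)) =
      x \<otimes> f k (n - k) \<oplus> f (Suc k) (n - k)" for k
    unfolding fx using x y by (simp add: f_def add.nat_pow_mult del: nat_pow_Suc)
  have "(\<Oplus>k\<in>{..Suc n}. [(Suc n choose k)] \<cdot> (x [^] k \<otimes> y [^] (Suc n - k)))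
      = (\<Oplus>k\<in>{..n}. x \<otimes> f k (n - k) \<oplus> f (Suc k) (n - k)) \<oplus> f 0 (Suc n)"
  proof -
    define g where "g k = [(Suc n choose k)] \<cdot> (x [^] k \<otimes> y [^] (Suc n - k))" for k
    have g: "g k \<in> carrier R" for k using x y by (simp add: g_def)
    have "g (Suc k) = x \<otimes> f k (n - k) \<oplus> f (Suc k) (n - k)" for k
      unfolding g_def by (rule step)
    moreover have "g 0 = f 0 (Suc n)"
      using x y by (simp add: g_def f_def)
    ultimately have "(\<Oplus>k\<in>{..Suc n}. g k) = (\<Oplus>k\<in>{..n}. x \<otimes> f k (n - k) \<oplus> f (Suc k) (n - k)) \<oplus> f 0 (Suc n)"
      using g by (subst finsum_Suc2) simp_all
    then show ?thesis by (simp only: g_def)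
  qed
  also have "\<dots> = x \<otimes> (\<Oplus>k\<in>{..n}. f k (n - k)) \<oplus> ((\<Oplus>k\<in>{..n}. f (Suc k) (n - k)) \<oplus> f 0 (Suc n))"
    using x f by (simp add: finsum_addf finsum_rdistr a_assoc)
  also have "(\<Oplus>k\<in>{..n}. f (Suc k) (n - k)) \<oplus> f 0 (Suc n) = (\<Oplus>k\<in>{..Suc n}. f k (Suc n - k))"
    using f by (subst finsum_Suc2) simp_all
  also have "\<dots> = (\<Oplus>k\<in>{..n}. f k (Suc n - k))"
  proof -
    have "f (Suc n) 0 = \<zero>"
      unfolding f_def using x y by (subst binomial_eq_0) simp_all
    then show ?thesis using f by (subst finsum_Suc) simp_all
  qed
  also have "\<dots> = (\<Oplus>k\<in>{..n}. y \<otimes> f k (n - k))"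
    using y f by (intro finsum_cong') (simp_all add: fy Suc_diff_le)
  also have "\<dots> = y \<otimes> (\<Oplus>k\<in>{..n}. f k (n - k))"
    using y f by (simp add: finsum_rdistr)
  finally show ?case
    using Suc x y f by (simp add: f_def l_distr m_comm)
qed

lemma (in cring) add_pow_eq_zero_if_dvd:
  fixes p m :: nat
  assumes "[p] \<cdot> \<one> = \<zero>" "p dvd m" "x \<in> carrier R"
  shows "[m] \<cdot> x = \<zero>"
proof -
  from assms(2) obtain k where m: "m = p * k" ..
  have "[p] \<cdot> x = ([p] \<cdot> \<one>) \<otimes> x"
    using assms(3) by (simp add: add_pow_ldistr)
  then show ?thesis
    using assms by (simp add: m add.nat_pow_pow[symmetric])
qed

text \<open>\<open>p\<close> divides every binomial coefficient strictly between the two ends, so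
  only the terms for 0 and \<open>p\<close> survive.\<close>

lemma (in cring) freshmans_dream:
  fixes p :: nat
  assumes "prime p" "[p] \<cdot> \<one> = \<zero>" and x: "x \<in> carrier R" and y: "y \<in> carrier R"
  shows "(x \<oplus> y) [^] p = x [^] p \<oplus> y [^] p"
proof -
  define g where "g k = [(p choose k)] \<cdot> (x [^] k \<otimes> y [^] (p - k))" for k
  have g: "g k \<in> carrier R" for k using x y by (simp add: g_def)
  have "(x \<oplus> y) [^] p = (\<Oplus>k\<in>{..p}. g k)"
    using x y by (simp add: binomial_theorem g_def)
  also have "\<dots> = (\<Oplus>k\<in>{0,p}. g k)"
  proof (rule add.finprod_mono_neutral_cong_right)
    fix k assume "k \<in> {..p} - {0,p}"
    then have "p dvd (p choose k)"
      using assms(1) by (intro dvd_choose_prime) auto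
    then show "g k = \<zero>"
      unfolding g_def using x y by (intro add_pow_eq_zero_if_dvd[OF assms(2)]) simp_all
  qed (use g in simp_all)
  also have "\<dots> = x [^] p \<oplus> y [^] p"
    using x y g prime_gt_0_nat[OF assms(1)]
    by (simp add: finsum_insert) (simp add: g_def a_comm)
  finally show ?thesis .
qed

lemma (in cring) frobenius_power_add:
  fixes p k :: nat
  assumes "prime p" "[p] \<cdot> \<one> = \<zero>" "x \<in> carrier R" "y \<in> carrier R"
  shows "(x \<oplus> y) [^] (p ^ k) = x [^] (p ^ k) \<oplus> y [^] (p ^ k)"
proof (induction k)
  case (Suc k)
  then show ?case
    using assms by (simp add: nat_pow_pow[symmetric] freshmans_dream power_Suc2 del: power_Suc)
qed (use assms in simp)

lemma (in domain) nonzero_nat_pow_nonzero: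
  assumes "x \<in> carrier R" "x \<noteq> \<zero>"
  shows "x [^] (k::nat) \<noteq> \<zero>"
  using assms by (induction k) (auto simp: integral_iff)

text \<open>The order of the additive group annihilates \<open>\<one>\<close>, so
  \<open>([p] \<cdot> \<one>) [^] m\<close> vanishes, and a domain has no nonzero
  nilpotents.\<close>

lemma (in domain) prime_add_pow_one_eq_zero:
  assumes "order R = p ^ m" "prime p"
  shows "[p] \<cdot> \<one> = \<zero>"
proof -
  have "[(p ^ k)] \<cdot> \<one> = ([p] \<cdot> \<one>) [^] k" for k
  proof (induction k)
    case (Suc k)
    have "[(p ^ Suc k)] \<cdot> \<one> = [p] \<cdot> ([(p ^ k)] \<cdot> \<one>)"
      by (simp add: add.nat_pow_pow mult.commute)
    also have "\<dots> = ([(p ^ k)] \<cdot> \<one>) \<otimes> ([p] \<cdot> \<one>)"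
      by (subst add_pow_rdistr) simp_all
    finally show ?case using Suc by simp
  qed simp
  moreover have "[order R] \<cdot> \<one> = \<zero>"
    using add.pow_order_eq_1[of \<one>] by (simp add: order_def)
  ultimately have "([p] \<cdot> \<one>) [^] m = \<zero>" using assms by simp
  then show ?thesis
    using nonzero_nat_pow_nonzero[of "[p] \<cdot> \<one>" m] by auto
qed

section \<open>Subfields as fixed sets of power maps\<close>

text \<open>Put d = |K| - 1. All nonzero elements of \<open>K\<close> satisfy x^d = 1, and this
  equation has at most d roots in a field, so it has no others. Membership thus becomes an equation
  between powers.\<close>

lemma (in field) mem_subfield_iff_pow_card:
  assumes "subfield K R" "finite (carrier R)" "x \<in> carrier R"
  shows "x \<in> K \<longleftrightarrow> x [^] card K = x"
proof -
  interpret K: subfield K R by fact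
  have sub: "K \<subseteq> carrier R" by (rule K.subset)
  then have fin: "finite K" using assms(2) finite_subset by blast
  have zeroK: "\<zero> \<in> K" and oneK: "\<one> \<in> K"
    using subringE[OF subfieldE(1)[OF assms(1)]] by blast+
  have Kf: "field (R \<lparr>carrier := K\<rparr>)" using assms(1) subfield_iff(2) by blast
  interpret KF: field "R \<lparr>carrier := K\<rparr>" by (rule Kf)
  have pow: "k [^]\<^bsub>R \<lparr>carrier := K\<rparr>\<^esub> (m::nat) = k [^] m" for k m
    by (simp add: nat_pow_def)
  have card: "card K = Suc (card (K - {\<zero>}))" 
    using card_Suc_Diff1[OF fin zeroK] by simp
  define d where "d = card (K - {\<zero>})"
  have "\<one> \<in> K - {\<zero>}" using oneK by simp
  then have d: "d > 0" using fin unfolding d_def by (metis card_gt_0_iff empty_iff finite_Diff)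
  have KU: "k [^] d = \<one>" if "k \<in> K - {\<zero>}" for k
    using KF.units_power_order_eq_one[of k] that fin KF.field_Units by (simp add: pow d_def)
  define S where "S = {x \<in> carrier R. x [^] d = \<one>}"
  have "card S \<le> d" 
    unfolding S_def using num_roots_le_deg[OF assms(2)] d by simp
  moreover have "K - {\<zero>} \<subseteq> S" using KU sub by (auto simp: S_def)
  moreover have "finite S" using assms(2) by (simp add: S_def)
  ultimately have S: "K - {\<zero>} = S" by (metis card_seteq d_def)
  show ?thesis
  proof (cases "x = \<zero>")
    case True
    then show ?thesis using card zeroK by (simp add: nat_pow_zero)
  next
    case False
    have "x [^] card K = x [^] d \<otimes> x" by (simp add: card d_def)
    then have "x [^] card K = x \<longleftrightarrow> x [^] d = \<one>"
      using False assms m_rcancel[of x "x [^] d" \<one>] by simp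
    then show ?thesis using S False assms by (auto simp: S_def)
  qed
qed

lemma (in monoid) pow_power_fixed_mult:
  fixes q a u :: nat
  assumes "x \<in> carrier G" "x [^] (q ^ a) = x"
  shows "x [^] (q ^ (a * u)) = x"
  using assms by (induction u) (simp_all add: power_add nat_pow_pow[symmetric])

text \<open>Bezout over the naturals gives a u = b v + gcd, so the map for a u is the map for b v
  followed by the map for the gcd, and both longer maps fix \<open>x\<close>. Applied to finite
  fields, this computes intersections of subfields.\<close>

lemma (in monoid) pow_power_fixed_gcd:
  fixes q a b :: nat
  assumes "x \<in> carrier G" "x [^] (q ^ a) = x" "x [^] (q ^ b) = x"
  shows "x [^] (q ^ gcd a b) = x"
\<comment> \<open>Bezout in this form needs \<open>a\<close> nonzero; for \<open>a = 0\<close> the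
  gcd is \<open>b\<close>.\<close>
proof (cases "a = 0")
  case False
  then obtain u v where uv: "a * u = b * v + gcd a b" using bezout_nat by blast
  have "x [^] (q ^ gcd a b) = (x [^] (q ^ (b * v))) [^] (q ^ gcd a b)"
    using assms by (simp add: pow_power_fixed_mult)
  also have "\<dots> = x [^] (q ^ (a * u))"
    using assms by (simp add: uv power_add nat_pow_pow)
  finally show ?thesis using assms by (simp add: pow_power_fixed_mult)
qed (use assms in simp)

lemma (in monoid) subset_closed_nat_pow:
  assumes "\<one> \<in> K" "\<And>x y. x \<in> K \<Longrightarrow> y \<in> K \<Longrightarrow> x \<otimes> y \<in> K" "x \<in> K"
  shows "x [^] (k::nat) \<in> K"
  using assms by (induction k) simp_all

lemma (in field) subfield_closed:
  assumes "subfield K R"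
  shows "\<zero> \<in> K" "\<one> \<in> K" "\<And>x. x \<in> K \<Longrightarrow> x \<in> carrier R"
    "\<And>x y. x \<in> K \<Longrightarrow> y \<in> K \<Longrightarrow> x \<otimes> y \<in> K"
    "\<And>x y. x \<in> K \<Longrightarrow> y \<in> K \<Longrightarrow> x \<oplus> y \<in> K"
    "\<And>x y. x \<in> K \<Longrightarrow> y \<in> K \<Longrightarrow> x \<ominus> y \<in> K"
    "\<And>x. x \<in> K \<Longrightarrow> \<ominus> x \<in> K"
    "\<And>x. x \<in> K \<Longrightarrow> x \<noteq> \<zero> \<Longrightarrow> inv x \<in> K"
    "\<And>x k. x \<in> K \<Longrightarrow> x [^] (k::nat) \<in> K"
proof -
  note K = subringE[OF subfieldE(1)[OF assms]]
  show "\<zero> \<in> K" "\<one> \<in> K" "\<And>x. x \<in> K \<Longrightarrow> x \<in> carrier R"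
    "\<And>x y. x \<in> K \<Longrightarrow> y \<in> K \<Longrightarrow> x \<otimes> y \<in> K"
    "\<And>x y. x \<in> K \<Longrightarrow> y \<in> K \<Longrightarrow> x \<oplus> y \<in> K"
    "\<And>x. x \<in> K \<Longrightarrow> \<ominus> x \<in> K"
    using K by auto
  then show "\<And>x y. x \<in> K \<Longrightarrow> y \<in> K \<Longrightarrow> x \<ominus> y \<in> K"
    "\<And>x k. x \<in> K \<Longrightarrow> x [^] (k::nat) \<in> K"
    by (auto simp: minus_eq intro: subset_closed_nat_pow)
  show "\<And>x. x \<in> K \<Longrightarrow> x \<noteq> \<zero> \<Longrightarrow> inv x \<in> K"
    using subfield_m_inv(1)[OF assms] by auto
qed

section \<open>Dimension and cardinality\<close>

text \<open>Extending \<open>E\<close> by a vector \<open>v\<close> outside it gives the sums k v +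
  e, each from exactly one pair, so every step of \<open>dimension\<close> multiplies the
  cardinality by |K|.\<close>

lemma (in ring) card_dimension:
  assumes "dimension n K E" "subfield K R" "finite K"
  shows "finite E \<and> card E = card K ^ n"
  using assms
proof (induction rule: dimension.induct)
  case (Suc_dim v E n K)
  note E = space_subgroup_props[OF Suc_dim.prems(1) Suc_dim.hyps(3)]
  note K = subringE[OF subfieldE(1)[OF Suc_dim.prems(1)]]
  have inj: "inj_on (\<lambda>(k, e). k \<otimes> v \<oplus> e) (K \<times> E)"
  proof (rule inj_onI, clarify)
    fix k e k' e' assume *: "k \<in> K" "e \<in> E" "k' \<in> K" "e' \<in> E" and eq: "k \<otimes> v \<oplus> e = k' \<otimes> v \<oplus> e'"
    have c: "k \<in> carrier R" "k' \<in> carrier R" "e \<in> carrier R" "e' \<in> carrier R"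
      using * K(1) E(1) by auto
    have "(k \<ominus> k') \<otimes> v = (k \<otimes> v \<oplus> e) \<ominus> k' \<otimes> v \<ominus> e"
      using c Suc_dim.hyps(1) by algebra
    also have "\<dots> = e' \<ominus> e"
      unfolding eq using c Suc_dim.hyps(1) by algebra
    finally have d: "(k \<ominus> k') \<otimes> v = e' \<ominus> e" .
    \<comment> \<open>A nonzero scalar multiple of \<open>v\<close> in \<open>E\<close> would put
      \<open>v\<close> itself into \<open>E\<close>.\<close>
    have "k \<ominus> k' = \<zero>"
    proof (rule ccontr)
      assume "k \<ominus> k' \<noteq> \<zero>"
      then have "k \<ominus> k' \<in> K - {\<zero>}" using * K by (auto simp: minus_eq)
      moreover have "(k \<ominus> k') \<otimes> v \<in> E" unfolding d using * E by (auto simp: minus_eq)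
      ultimately show False using E(6) Suc_dim.hyps by blast
    qed
    then have "k = k'" using c by (simp add: r_right_minus_eq)
    then show "k = k' \<and> e = e'" using eq c Suc_dim.hyps(1) by simp
  qed
  have img: "line_extension K v E = (\<lambda>(k, e). k \<otimes> v \<oplus> e) ` (K \<times> E)"
    by (auto simp: line_extension_mem_iff image_iff) blast
  from Suc_dim show ?case
    unfolding img card_image[OF inj] by (simp add: card_cartesian_product)
qed simp

text \<open>\<open>V\<close> lies in the span of a list of all field elements, so it has some finite
  dimension e; then |K|^e = |K|^d with |K| > 1 forces e = d. The dimensions of \<open>Fq3n\<close>,
  \<open>U\<close> and \<open>F\<close> below are found by counting in this way.\<close>

lemma (in field) dimension_if_card_eq:
  assumes "subfield K R" "finite (carrier R)" "subalgebra K V R" "card V = card K ^ d"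
  shows "dimension d K V"
proof -
  note K = subfield_closed[OF assms(1)]
  have finK: "finite K" using K(3) assms(2) by (meson finite_subset subsetI)
  obtain xs where xs: "set xs = carrier R" using assms(2) finite_list by blast
  have "finite_dimension K (Span K xs)"
    using Span_finite_dimension[OF assms(1)] xs by simp
  moreover have "V \<subseteq> Span K xs"
    using Span_base_incl[OF assms(1)] xs subalgebra_in_carrier[OF assms(3)] by blast
  ultimately obtain e where e: "dimension e K V"
    using subalbegra_incl_imp_finite_dimension[OF assms(1) _ assms(3)] finite_dimensionE' by metis
  have "card {\<zero>, \<one>} \<le> card K" using finK K by (intro card_mono) auto
  then have "1 < card K" by simp
  moreover have "card K ^ e = card K ^ d"
    using card_dimension[OF e assms(1) finK] assms(4) by simp
  ultimately show ?thesis using e by simp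
qed

section \<open>Products of conjugates and the norm\<close>

lemma (in comm_monoid) finprod_lessThan_Suc:
  assumes "\<And>k. f k \<in> carrier G"
  shows "(\<Otimes>k\<in>{..<Suc j}. f k) = (\<Otimes>k\<in>{..<j}. f k) \<otimes> f j"
  using assms by (simp add: lessThan_Suc m_comm)

lemma (in cring) pow_power_add:
  assumes "\<And>x y. x \<in> carrier R \<Longrightarrow> y \<in> carrier R \<Longrightarrow> (x \<oplus> y) [^] s = x [^] s \<oplus> y [^] s"
    and "x \<in> carrier R" "y \<in> carrier R"
  shows "(x \<oplus> y) [^] (s ^ k :: nat) = x [^] (s ^ k) \<oplus> y [^] (s ^ k)"
proof (induction k)
  case (Suc k)
  then show ?case using assms
    by (simp add: nat_pow_pow[symmetric] power_Suc2 del: power_Suc)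
qed (use assms in simp)

text \<open>Applying the s^j-th power map to \<open>rel\<close> and multiplying by the product of
  the first j conjugates yields a two-term recurrence. Its coefficients are powers of
  \<open>A\<close> and \<open>C\<close>: they may vary with j, but they remain in
  \<open>K\<close>.\<close>

lemma (in field) conjugate_products_in_line:
  fixes s :: nat
  assumes K: "subfield K R"
    and add: "\<And>x y. x \<in> carrier R \<Longrightarrow> y \<in> carrier R \<Longrightarrow> (x \<oplus> y) [^] s = x [^] s \<oplus> y [^] s"
    and z: "z \<in> carrier R" and A: "A \<in> K" and C: "C \<in> K"
    and rel: "z \<otimes> z [^] s = A \<oplus> C \<otimes> z"
  shows "\<exists>\<alpha>\<in>K. \<exists>\<beta>\<in>K. (\<Otimes>k\<in>{..<j}. z [^] (s ^ k)) = \<alpha> \<otimes> z \<oplus> \<beta>"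
proof -
  note Kc = subfield_closed[OF K]
  define w where "w j = (\<Otimes>k\<in>{..<j}. z [^] (s ^ k))" for j
  have wc: "w j \<in> carrier R" for j using z by (simp add: w_def)
  have wS: "w (Suc j) = w j \<otimes> z [^] (s ^ j)" for j
    using z by (simp add: w_def finprod_lessThan_Suc)
  have rel_j: "z [^] (s ^ j) \<otimes> z [^] (s ^ Suc j) = A [^] (s ^ j) \<oplus> C [^] (s ^ j) \<otimes> z [^] (s ^ j)" for j
  proof -
    have "z [^] (s ^ j) \<otimes> z [^] (s ^ Suc j) = (z \<otimes> z [^] s) [^] (s ^ j)"
      using z by (simp add: nat_pow_distrib nat_pow_pow)
    also have "\<dots> = A [^] (s ^ j) \<oplus> (C \<otimes> z) [^] (s ^ j)"
      unfolding rel using A C z Kc(3) by (intro pow_power_add[OF add]) simp_all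
    finally show ?thesis using C z Kc(3) by (simp add: nat_pow_distrib)
  qed
  have step: "w (Suc (Suc j)) = A [^] (s ^ j) \<otimes> w j \<oplus> C [^] (s ^ j) \<otimes> w (Suc j)" for j
  proof -
    have c: "A [^] (s ^ j) \<in> carrier R" "C [^] (s ^ j) \<in> carrier R" "z [^] (s ^ j) \<in> carrier R"
        "z [^] (s ^ Suc j) \<in> carrier R"
      using A C z Kc(3) by simp_all
    have "w (Suc (Suc j)) = w j \<otimes> (z [^] (s ^ j) \<otimes> z [^] (s ^ Suc j))"
      using wc c by (simp add: wS m_assoc del: power_Suc)
    also have "\<dots> = A [^] (s ^ j) \<otimes> w j \<oplus> C [^] (s ^ j) \<otimes> (w j \<otimes> z [^] (s ^ j))"
      unfolding rel_j using wc[of j] c by algebra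
    finally show ?thesis by (simp add: wS)
  qed
  define P where "P x \<longleftrightarrow> (\<exists>\<alpha>\<in>K. \<exists>\<beta>\<in>K. x = \<alpha> \<otimes> z \<oplus> \<beta>)" for x
  have lin: "P (a \<otimes> x \<oplus> b \<otimes> y)" if "P x" "P y" "a \<in> K" "b \<in> K" for a b x y
  proof -
    from that obtain c d e f where *: "c \<in> K" "d \<in> K" "e \<in> K" "f \<in> K" "x = c \<otimes> z \<oplus> d" "y = e \<otimes> z \<oplus> f"
      unfolding P_def by blast
    have car: "a \<in> carrier R" "b \<in> carrier R" "c \<in> carrier R" "d \<in> carrier R" "e \<in> carrier R" "f \<in> carrier R"
      using * that Kc(3) by auto
    have "a \<otimes> x \<oplus> b \<otimes> y = (a \<otimes> c \<oplus> b \<otimes> e) \<otimes> z \<oplus> (a \<otimes> d \<oplus> b \<otimes> f)"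
      unfolding * using car z by algebra
    moreover have "a \<otimes> c \<oplus> b \<otimes> e \<in> K" "a \<otimes> d \<oplus> b \<otimes> f \<in> K"
      using * that Kc(4,5) by simp_all
    ultimately show ?thesis unfolding P_def by metis
  qed
  \<comment> \<open>The recurrence reaches two steps back, so the induction carries two consecutive
    products, starting from 1 and \<open>z\<close>.\<close>
  have "P (w j) \<and> P (w (Suc j))"
  proof (induction j)
    case 0
    have "w 0 = \<zero> \<otimes> z \<oplus> \<one>" "w (Suc 0) = \<one> \<otimes> z \<oplus> \<zero>"
      using z by (simp_all add: w_def lessThan_Suc)
    then show ?case unfolding P_def using Kc(1,2) by blast
  next
    case (Suc j)
    then show ?case unfolding step by (simp add: lin Kc(9) A C)
  qed
  then show ?thesis unfolding P_def w_def by blast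
qed

text \<open>The power map \<open>f\<close> fixes \<open>b\<close> and \<open>c\<close>, so it sends
  roots of the quadratic to roots. Among \<open>z\<close>, \<open>f z\<close> and
  \<open>f (f z)\<close> two must agree, and as the third iterate of \<open>f\<close> returns to
  \<open>z\<close>, all three agree.\<close>

lemma (in field) quadratic_of_cubic_extension_in_subfield:
  assumes K: "subfield K R" and fin: "finite (carrier R)"
    and add: "\<And>x y. x \<in> carrier R \<Longrightarrow> y \<in> carrier R \<Longrightarrow> (x \<oplus> y) [^] card K = x [^] card K \<oplus> y [^] card K"
    and z: "z \<in> carrier R" "z [^] (card K ^ 3) = z"
    and bc: "b \<in> K" "c \<in> K" and quad: "z \<otimes> z = b \<otimes> z \<oplus> c"
  shows "z \<in> K"
proof -
  note Kc = subfield_closed[OF K]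
  note mem = mem_subfield_iff_pow_card[OF K fin]
  define f where "f x = x [^] card K" for x
  have b: "b \<in> carrier R" and c: "c \<in> carrier R" using bc Kc(3) by auto
  have fc: "f x \<in> carrier R" if "x \<in> carrier R" for x using that by (simp add: f_def)
  have f3: "f (f (f z)) = z" using z by (simp add: f_def nat_pow_pow power3_eq_cube)
  have quad': "f x \<otimes> f x = b \<otimes> f x \<oplus> c" if "x \<in> carrier R" "x \<otimes> x = b \<otimes> x \<oplus> c" for x
  proof -
    have "f x \<otimes> f x = f (x \<otimes> x)" using that(1) by (simp add: f_def nat_pow_distrib)
    also have "\<dots> = f b \<otimes> f x \<oplus> f c"
      unfolding that(2) f_def using that(1) b c by (simp add: add nat_pow_distrib)
    finally show ?thesis using mem bc b c by (simp add: f_def)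
  qed
  have roots: "x = y \<or> y = b \<ominus> x"
    if "x \<in> carrier R" "x \<otimes> x = b \<otimes> x \<oplus> c" "y \<in> carrier R" "y \<otimes> y = b \<otimes> y \<oplus> c" for x y
  proof -
    \<comment> \<open>The product is the difference of the values of X^2 - b X at the two roots, and
      both values are \<open>c\<close>.\<close>
    have "(x \<ominus> y) \<otimes> (y \<ominus> (b \<ominus> x)) = (x \<otimes> x \<ominus> b \<otimes> x) \<ominus> (y \<otimes> y \<ominus> b \<otimes> y)"
      using that(1,3) b by algebra
    also have "\<dots> = \<zero>" unfolding that(2,4) using that(1,3) b c by algebra
    finally show ?thesis using that b integral_iff[of "x \<ominus> y" "y \<ominus> (b \<ominus> x)"] by (auto simp: r_right_minus_eq)
  qed
  note q1 = quad'[OF z(1) quad]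
  note q2 = quad'[OF fc[OF z(1)] q1]
  \<comment> \<open>If neither conjugate equals \<open>z\<close>, then both equal b - z.\<close>
  have "f z = z \<or> f (f z) = z \<or> f z = f (f z)"
    using roots[OF z(1) quad fc[OF z(1)] q1] roots[OF z(1) quad fc[OF fc[OF z(1)]] q2] by metis
  then have "f z = z" using f3 by metis
  then show ?thesis using mem z by (simp add: f_def)
qed

text \<open>The factors (x^s / x)^(s^k) telescope to x^(s^j) / x; the extra factor \<open>x\<close>
  clears the denominator. Once the s^j-th power map fixes \<open>x\<close>, it cancels and only the
  conjugates of \<open>a\<close> are left.\<close>

lemma (in field) norm_product_quotient:
  fixes s :: nat
  assumes "a \<in> carrier R" "x \<in> carrier R" "x \<noteq> \<zero>"
  shows "(\<Otimes>k\<in>{..<j}. (a \<otimes> x [^] s \<otimes> inv x) [^] (s ^ k)) \<otimes> x = (\<Otimes>k\<in>{..<j}. a [^] (s ^ k)) \<otimes> x [^] (s ^ j)"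
proof (induction j)
  case (Suc j)
  have i: "inv x \<in> carrier R" "x \<otimes> inv x = \<one>" using assms field_Units by simp_all
  define z where "z = a \<otimes> x [^] s \<otimes> inv x"
  have z: "z \<in> carrier R" using assms i by (simp add: z_def)
  have zx: "z \<otimes> x = a \<otimes> x [^] s" using assms i by (simp add: z_def m_assoc m_comm[of "inv x"])
  define w where "w = (\<Otimes>k\<in>{..<j}. z [^] (s ^ k))"
  define v where "v = (\<Otimes>k\<in>{..<j}. a [^] (s ^ k))"
  have c: "w \<in> carrier R" "v \<in> carrier R" using z assms by (simp_all add: w_def v_def)
  have IH: "w \<otimes> x = v \<otimes> x [^] (s ^ j)" using Suc by (simp add: w_def v_def z_def)
  have "w \<otimes> z [^] (s ^ j) \<otimes> x = w \<otimes> x \<otimes> z [^] (s ^ j)"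
    using c z assms by (simp add: m_ac)
  also have "\<dots> = v \<otimes> (z \<otimes> x) [^] (s ^ j)"
    unfolding IH using c z assms by (simp add: nat_pow_distrib m_ac)
  also have "\<dots> = v \<otimes> a [^] (s ^ j) \<otimes> x [^] (s ^ Suc j)"
    unfolding zx using c z assms by (simp add: nat_pow_distrib nat_pow_pow m_ac)
  finally show ?case
    using z assms unfolding z_def[symmetric] by (simp add: finprod_lessThan_Suc w_def v_def del: power_Suc)
qed (use assms in simp)

text \<open>Raising to the power \<open>Q\<close> shifts each conjugate to the next, and the last
  one returns to \<open>a\<close>.\<close>

lemma (in field) norm_product_fixed:
  fixes Q :: nat
  assumes a: "a \<in> carrier R" "a \<noteq> \<zero>" "a [^] (Q ^ n) = a"
  shows "(\<Otimes>k\<in>{..<n}. a [^] (Q ^ k)) [^] Q = (\<Otimes>k\<in>{..<n}. a [^] (Q ^ k))"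
proof -
  define v where "v j = (\<Otimes>k\<in>{..<j}. a [^] (Q ^ k))" for j
  have c: "v j \<in> carrier R" for j using a by (simp add: v_def)
  have vS: "v (Suc j) = v j \<otimes> a [^] (Q ^ j)" for j
    using a by (simp add: v_def finprod_lessThan_Suc)
  \<comment> \<open>The factor \<open>a\<close> lost by the shift is restored on the left, which
    gives a form for partial products that admits induction; at \<open>j = n\<close> it
    cancels.\<close>
  have "v j [^] Q \<otimes> a = v j \<otimes> a [^] (Q ^ j)" for j
  proof (induction j)
    case 0 show ?case using a by (simp add: v_def)
  next
    case (Suc j)
    have "v (Suc j) [^] Q \<otimes> a = v j [^] Q \<otimes> a \<otimes> a [^] (Q ^ Suc j)"
      using a c by (simp add: vS nat_pow_distrib nat_pow_pow m_ac mult.commute)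
    then show ?case using Suc by (simp add: vS)
  qed
  from this[of n] show ?thesis
    using a c[of n] m_rcancel[of a "v n [^] Q" "v n"] by (simp add: v_def)
qed

text \<open>Exponents matter only modulo \<open>n\<close>, and multiplication by \<open>m\<close>
  permutes the residues. This allows the norm, defined with steps of q^3, to be formed with steps of
  q^i.\<close>

lemma (in comm_monoid) norm_product_reindex:
  fixes Q m n :: nat
  assumes a: "a \<in> carrier G" "a [^] (Q ^ n) = a" and "coprime m n" "n > 0"
  shows "(\<Otimes>k\<in>{..<n}. a [^] ((Q ^ m) ^ k)) = (\<Otimes>k\<in>{..<n}. a [^] (Q ^ k))"
proof -
  define h where "h k = m * k mod n" for k
  have red: "a [^] (Q ^ k) = a [^] (Q ^ (k mod n))" for k
  proof -
    have "a [^] (Q ^ k) = a [^] (Q ^ (n * (k div n) + k mod n))" by simp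
    also have "\<dots> = (a [^] (Q ^ (n * (k div n)))) [^] (Q ^ (k mod n))"
      using a unfolding power_add by (simp add: nat_pow_pow)
    finally show ?thesis using a by (simp add: pow_power_fixed_mult)
  qed
  have inj: "inj_on h {..<n}"
  proof (rule inj_onI)
    fix j k assume *: "j \<in> {..<n}" "k \<in> {..<n}" "h j = h k"
    then have "[m * j = m * k] (mod n)" by (simp add: h_def cong_def)
    then have "[j = k] (mod n)" using assms(3) cong_mult_lcancel_nat by blast
    then show "j = k" using * by (simp add: cong_def)
  qed
  have "h ` {..<n} \<subseteq> {..<n}" using assms(4) by (auto simp: h_def)
  then have img: "h ` {..<n} = {..<n}"
    using inj by (simp add: card_image card_subset_eq)
  have "(\<Otimes>k\<in>{..<n}. a [^] ((Q ^ m) ^ k)) = (\<Otimes>k\<in>{..<n}. a [^] (Q ^ h k))"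
    using a by (intro finprod_cong') (simp_all add: h_def red[of "m * k" for k, symmetric] power_mult)
  also have "\<dots> = (\<Otimes>k\<in>h ` {..<n}. a [^] (Q ^ k))"
    using a inj by (subst finprod_reindex) simp_all
  finally show ?thesis by (simp add: img)
qed

section \<open>Coordinates over a subfield and spans of one vector\<close>

text \<open>If \<open>c\<close> and \<open>e\<close> differed, dividing (c - e) w = d - b by c - e
  would put \<open>w\<close> into \<open>E\<close>. It serves for coordinates over
  \<open>Fqn\<close> as well as over \<open>Fq3n\<close>.\<close>

lemma (in field) subfield_coefficients_unique:
  assumes "subfield E R" "w \<in> carrier R" "w \<notin> E"
    and E: "b \<in> E" "c \<in> E" "d \<in> E" "e \<in> E" and eq: "b \<oplus> c \<otimes> w = d \<oplus> e \<otimes> w"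
  shows "b = d \<and> c = e"
proof -
  note Ec = subfield_closed[OF assms(1)]
  have car: "b \<in> carrier R" "c \<in> carrier R" "d \<in> carrier R" "e \<in> carrier R"
    using E Ec(3) by auto
  have "(c \<ominus> e) \<otimes> w = (b \<oplus> c \<otimes> w) \<ominus> e \<otimes> w \<ominus> b" using car assms(2) by algebra
  also have "\<dots> = d \<ominus> b" unfolding eq using car assms(2) by algebra
  finally have *: "(c \<ominus> e) \<otimes> w = d \<ominus> b" .
  have "c \<ominus> e = \<zero>"
  proof (rule ccontr)
    assume nz: "c \<ominus> e \<noteq> \<zero>"
    then have u: "c \<ominus> e \<in> Units R" using car field_Units by auto
    have "w = inv (c \<ominus> e) \<otimes> ((c \<ominus> e) \<otimes> w)"
      using u car assms(2) by (simp add: m_assoc[symmetric])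
    also have "\<dots> = inv (c \<ominus> e) \<otimes> (d \<ominus> b)" by (simp only: *)
    also have "\<dots> \<in> E" using nz E Ec(4,6,8) by simp
    finally show False using assms(3) by contradiction
  qed
  then have "c = e" using car by simp
  then show ?thesis using eq car assms(2) by simp
qed

lemma (in ring) Span_singleton:
  assumes "subfield K R" "u \<in> carrier R"
  shows "Span K [u] = {k \<otimes> u | k. k \<in> K}"
proof -
  have "K \<subseteq> carrier R" using subfieldE(3)[OF assms(1)] .
  then show ?thesis using assms(2) by (auto simp: line_extension_mem_iff subset_eq)
qed

lemma (in ring) dimension_Span_singleton:
  assumes "u \<in> carrier R" "u \<noteq> \<zero>"
  shows "dimension 1 K (Span K [u])"
  using dimension_independent[of K "[u]"] assms li_Cons[of u K "[]"] by simp

section \<open>The tower of subfields and the position of omega\<close>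

text \<open>The subfields are given by their orders; inclusions among them are derived from the
  fixed-point criterion.\<close>

locale linear_set_setting = field F for F (structure) +
  fixes q n i :: nat
    and Fq Fqn Fq3 Fq2n Fq3n :: "'a set"
    and \<omega> a :: 'a
  assumes primepow_q: "primepow q"
    and n_pos: "n > 0" and n_mod_3: "\<not> [n = 0] (mod 3)"
    and order: "order F = q ^ (6 * n)"
    and Fq: "subfield Fq F" and card_Fq: "card Fq = q"
    and Fqn: "subfield Fqn F" and card_Fqn: "card Fqn = q ^ n"
    and Fq3: "subfield Fq3 F" and card_Fq3: "card Fq3 = q ^ 3"
    and Fq2n: "subfield Fq2n F" and card_Fq2n: "card Fq2n = q ^ (2 * n)"
    and Fq3n: "subfield Fq3n F" and card_Fq3n: "card Fq3n = q ^ (3 * n)"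
    and omega: "\<omega> \<in> Fq2n - Fqn"
    and a: "a \<in> Fq3n - {\<zero>}"
    and gcd_i_2n: "gcd i (2 * n) = 1" and gcd_i_3n: "gcd i (3 * n) = 3"
    and norm_a: "finite_field_norm Fq3n Fq3 a \<notin> Fq"
begin

text \<open>The parametrisation of \<open>U\<close>. In the basis 1, \<open>\<omega>\<close> over
  \<open>Fq3n\<close> the coordinates of \<open>phi x\<close> are a x^(q^i) and x.\<close>

definition phi :: "'a \<Rightarrow> 'a" where
  "phi x = a \<otimes> x [^] (q ^ i) \<oplus> x \<otimes> \<omega>"

lemma q_gt_1: "q > 1"
  using primepow_q by (simp add: primepow_gt_Suc_0)

lemma finite_carrier: "finite (carrier F)"
  using order q_gt_1 by (simp add: order_def card_ge_0_finite)

lemma frobenius_add: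
  assumes "x \<in> carrier F" "y \<in> carrier F"
  shows "(x \<oplus> y) [^] (q ^ k) = x [^] (q ^ k) \<oplus> y [^] (q ^ k)"
proof -
  obtain p e where p: "prime p" "q = p ^ e"
    using primepow_q unfolding primepow_def by auto
  then have "[p] \<cdot> \<one> = \<zero>"
    using order by (intro prime_add_pow_one_eq_zero[of p "e * (6 * n)"]) (simp_all add: power_mult)
  then show ?thesis
    using frobenius_power_add[OF p(1) _ assms, of "e * k"] by (simp add: p(2) power_mult)
qed

text \<open>The exponents have the shape q^(n * u) so that \<open>pow_power_fixed_mult\<close>
  yields inclusions directly; q^1 is the shape in which a gcd equal to 1 arrives.\<close>

lemma mem_Fq_iff: "x \<in> carrier F \<Longrightarrow> x \<in> Fq \<longleftrightarrow> x [^] (q ^ 1) = x"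
  and mem_Fqn_iff: "x \<in> carrier F \<Longrightarrow> x \<in> Fqn \<longleftrightarrow> x [^] (q ^ n) = x"
  and mem_Fq3_iff: "x \<in> carrier F \<Longrightarrow> x \<in> Fq3 \<longleftrightarrow> x [^] (q ^ 3) = x"
  and mem_Fq2n_iff: "x \<in> carrier F \<Longrightarrow> x \<in> Fq2n \<longleftrightarrow> x [^] (q ^ (n * 2)) = x"
  and mem_Fq3n_iff: "x \<in> carrier F \<Longrightarrow> x \<in> Fq3n \<longleftrightarrow> x [^] (q ^ (n * 3)) = x"
  using mem_subfield_iff_pow_card[OF Fq finite_carrier] mem_subfield_iff_pow_card[OF Fqn finite_carrier]
    mem_subfield_iff_pow_card[OF Fq3 finite_carrier] mem_subfield_iff_pow_card[OF Fq2n finite_carrier]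
    mem_subfield_iff_pow_card[OF Fq3n finite_carrier]
    card_Fq card_Fqn card_Fq3 card_Fq2n card_Fq3n by (simp_all add: mult.commute)

lemmas Fq_closed = subfield_closed[OF Fq]
lemmas Fqn_closed = subfield_closed[OF Fqn]
lemmas Fq3_closed = subfield_closed[OF Fq3]
lemmas Fq2n_closed = subfield_closed[OF Fq2n]
lemmas Fq3n_closed = subfield_closed[OF Fq3n]

lemma Fq_power: "x \<in> Fq \<Longrightarrow> x [^] (q ^ k) = x"
  using mem_Fq_iff[of x] Fq_closed(3) pow_power_fixed_mult[of x q 1 k] by simp

lemma Fqn_subset_Fq2n: "x \<in> Fqn \<Longrightarrow> x \<in> Fq2n"
  using mem_Fqn_iff mem_Fq2n_iff Fqn_closed(3) pow_power_fixed_mult by blast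

lemma Fqn_subset_Fq3n: "x \<in> Fqn \<Longrightarrow> x \<in> Fq3n"
  using mem_Fqn_iff mem_Fq3n_iff Fqn_closed(3) pow_power_fixed_mult by blast

lemma Fq_subset_Fq3n: "x \<in> Fq \<Longrightarrow> x \<in> Fq3n"
  using Fq_power mem_Fq3n_iff Fq_closed(3) by blast

lemma Fq_subset_Fq2n: "x \<in> Fq \<Longrightarrow> x \<in> Fq2n"
  using Fq_power mem_Fq2n_iff Fq_closed(3) by blast

lemma omega_carrier: "\<omega> \<in> carrier F" and a_carrier: "a \<in> carrier F"
  using omega a Fq2n_closed(3) Fq3n_closed(3) by auto

text \<open>Since 3n = 2n + n, an element fixed by the powers q^(3n) and q^(2n) is fixed by q^n,
  which would put \<open>\<omega>\<close> into \<open>Fqn\<close>.\<close>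

lemma omega_notin_Fq3n: "\<omega> \<notin> Fq3n"
proof
  assume "\<omega> \<in> Fq3n"
  then have "\<omega> [^] (q ^ (n * 2 + n)) = \<omega>"
    using mem_Fq3n_iff omega_carrier by (simp add: mult.commute)
  then have "(\<omega> [^] (q ^ (n * 2))) [^] (q ^ n) = \<omega>"
    using omega_carrier by (simp only: power_add nat_pow_pow)
  then show False
    using mem_Fq2n_iff mem_Fqn_iff omega omega_carrier by simp
qed

lemma coprime_i_n: "coprime i n"
  using gcd_i_2n by (metis coprime_iff_gcd_eq_1 coprime_mult_right_iff)

lemma three_dvd_i: "3 dvd i"
  using gcd_i_3n by (metis gcd_dvd1)

text \<open>Counting: the q^n * q^n pairs map injectively into a set of q^(2n) elements, hence onto
  it.\<close>

lemma Fq2n_coefficients: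
  assumes "l \<in> Fq2n"
  obtains s t where "s \<in> Fqn" "t \<in> Fqn" "l = s \<oplus> t \<otimes> \<omega>"
proof -
  define f where "f = (\<lambda>(s, t). s \<oplus> t \<otimes> \<omega>)"
  have "inj_on f (Fqn \<times> Fqn)"
    using subfield_coefficients_unique[OF Fqn omega_carrier] omega
    by (intro inj_onI) (auto simp: f_def)
  then have "card (f ` (Fqn \<times> Fqn)) = card Fq2n"
    by (simp add: card_image card_cartesian_product card_Fqn card_Fq2n mult_2 power_add)
  moreover have "f ` (Fqn \<times> Fqn) \<subseteq> Fq2n"
    using Fqn_subset_Fq2n omega Fq2n_closed(4,5) by (auto simp: f_def)
  moreover have "finite Fq2n" using card_Fq2n q_gt_1 by (simp add: card_ge_0_finite)
  ultimately have "f ` (Fqn \<times> Fqn) = Fq2n" by (simp add: card_subset_eq)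
  then show ?thesis using assms that by (auto simp: f_def)
qed

text \<open>With i = 3 m and \<open>m\<close> coprime to \<open>n\<close>, the conjugates along q^i
  rearrange those along q^3 that define the norm.\<close>

lemma norm_eq_product: "finite_field_norm Fq3n Fq3 a = (\<Otimes>k\<in>{..<n}. a [^] ((q ^ i) ^ k))"
  and norm_in_Fq3: "finite_field_norm Fq3n Fq3 a \<in> Fq3"
proof -
  have "subalgebra Fq3 Fq3n F"
  proof -
    have "x \<in> Fq3n" if "x \<in> Fq3" for x
      using that mem_Fq3_iff[of x] mem_Fq3n_iff[of x] Fq3_closed(3) pow_power_fixed_mult[of x q 3 n]
      by (simp add: mult.commute)
    then show ?thesis
      using subring.axioms(1)[OF subfieldE(1)[OF Fq3n]] Fq3n_closed(4)
      by (auto simp: subalgebra_def subalgebra_axioms_def)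
  qed
  then have "dimension n Fq3 Fq3n"
    by (intro dimension_if_card_eq[OF Fq3 finite_carrier]) (simp_all add: card_Fq3 card_Fq3n power_mult)
  then have dim: "dim Fq3 Fq3n = n"
    using dimI[OF Fq3] by (simp add: over_def)
  obtain m where m: "i = 3 * m" using three_dvd_i ..
  have a_fixed: "a [^] ((q ^ 3) ^ n) = a"
    using mem_Fq3n_iff[OF a_carrier] a by (simp add: power_mult[symmetric] mult.commute)
  have "coprime m n" using coprime_i_n m by simp
  then show "finite_field_norm Fq3n Fq3 a = (\<Otimes>k\<in>{..<n}. a [^] ((q ^ i) ^ k))"
    using norm_product_reindex[OF a_carrier a_fixed, of m] n_pos
    by (simp add: finite_field_norm_def dim card_Fq3 m power_mult)
  show "finite_field_norm Fq3n Fq3 a \<in> Fq3"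
    using norm_product_fixed[OF a_carrier _ a_fixed] a a_carrier
    by (subst mem_Fq3_iff) (simp_all add: finite_field_norm_def dim card_Fq3)
qed

section \<open>Exclusion of the relation by the norm condition\<close>

text \<open>This settles the case t \<noteq> 0 for a multiplier s + t omega, and it is where the
  hypotheses on the norm of \<open>a\<close> and on \<open>n\<close> modulo 3 enter.\<close>

lemma no_fractional_relation:
  assumes x: "x \<in> Fq3n" "x \<noteq> \<zero>" and AC: "A \<in> Fqn" "C \<in> Fqn"
    and z: "z = a \<otimes> x [^] (q ^ i) \<otimes> inv x"
  shows "z \<otimes> z [^] (q ^ i) \<noteq> A \<oplus> C \<otimes> z"
proof
  assume rel: "z \<otimes> z [^] (q ^ i) = A \<oplus> C \<otimes> z"
  have zE: "z \<in> Fq3n" using x a Fq3n_closed(4,8,9) by (simp add: z)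
  then have zc: "z \<in> carrier F" by (rule Fq3n_closed(3))
  have xc: "x \<in> carrier F" using x Fq3n_closed(3) by simp
  obtain m where m: "i = 3 * m" using three_dvd_i ..
  \<comment> \<open>The exponent i n = 3 n m is a multiple of 3 n.\<close>
  have fix_n: "y [^] ((q ^ i) ^ n) = y" if "y \<in> Fq3n" for y
    using that mem_Fq3n_iff[of y] Fq3n_closed(3) pow_power_fixed_mult[of y q "n * 3" m]
    by (simp add: m power_mult[symmetric] mult_ac)
  define N where "N j = (\<Otimes>k\<in>{..<j}. z [^] ((q ^ i) ^ k))" for j
  have Nc: "N j \<in> carrier F" for j using zc by (simp add: N_def)
  have Nn: "N n = finite_field_norm Fq3n Fq3 a"
  proof -
    have v: "finite_field_norm Fq3n Fq3 a \<in> carrier F" using norm_in_Fq3 Fq3_closed(3) by blast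
    have "N n \<otimes> x = finite_field_norm Fq3n Fq3 a \<otimes> x"
      using norm_product_quotient[OF a_carrier xc x(2), of "q ^ i" n] fix_n[OF x(1)]
      by (simp add: N_def z norm_eq_product)
    then show ?thesis using m_rcancel xc x(2) Nc v by simp
  qed
  note line = conjugate_products_in_line[OF Fqn frobenius_add zc AC rel]
  obtain \<alpha> \<beta> where ab: "\<alpha> \<in> Fqn" "\<beta> \<in> Fqn" "N n = \<alpha> \<otimes> z \<oplus> \<beta>"
    using line[of n] by (auto simp: N_def)
  obtain \<gamma> \<delta> where cd: "\<gamma> \<in> Fqn" "\<delta> \<in> Fqn" "N (Suc n) = \<gamma> \<otimes> z \<oplus> \<delta>"
    using line[of "Suc n"] by (auto simp: N_def)
  have car: "\<alpha> \<in> carrier F" "\<beta> \<in> carrier F" "\<gamma> \<in> carrier F" "\<delta> \<in> carrier F"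
    using ab cd Fqn_closed(3) by auto
  \<comment> \<open>The factor of index \<open>n\<close> is z itself, because the cycle of
    conjugates closes there.\<close>
  have Suc: "N (Suc n) = N n \<otimes> z"
    using zc fix_n[OF zE] by (simp add: N_def finprod_lessThan_Suc)
  have "N n \<in> Fqn"
  proof (cases "\<alpha> = \<zero>")
    case True
    then show ?thesis using ab car zc by simp
  next
    case False
    then have u: "inv \<alpha> \<in> carrier F" "inv \<alpha> \<otimes> \<alpha> = \<one>" "inv \<alpha> \<in> Fqn"
      using car field_Units ab Fqn_closed(8) by simp_all
    \<comment> \<open>Equating the two expressions for \<open>N (Suc n)\<close> gives a quadratic
      equation for \<open>z\<close> over \<open>Fqn\<close> with leading coefficient
      \<open>\<alpha>\<close>; yet \<open>z\<close> lies in the cubic extension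
      \<open>Fq3n\<close>.\<close>
    have "\<alpha> \<otimes> (z \<otimes> z) = (\<alpha> \<otimes> z \<oplus> \<beta>) \<otimes> z \<ominus> \<beta> \<otimes> z" using car zc by algebra
    also have "\<dots> = \<gamma> \<otimes> z \<oplus> \<delta> \<ominus> \<beta> \<otimes> z" using Suc ab(3) cd(3) by simp
    finally have eq: "\<alpha> \<otimes> (z \<otimes> z) = \<gamma> \<otimes> z \<oplus> \<delta> \<ominus> \<beta> \<otimes> z" .
    have "z \<otimes> z = (inv \<alpha> \<otimes> \<alpha>) \<otimes> (z \<otimes> z)" using u zc by simp
    also have "\<dots> = inv \<alpha> \<otimes> (\<gamma> \<otimes> z \<oplus> \<delta> \<ominus> \<beta> \<otimes> z)"
      using u(1) car zc by (simp add: m_assoc eq)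
    also have "\<dots> = (inv \<alpha> \<otimes> (\<gamma> \<ominus> \<beta>)) \<otimes> z \<oplus> inv \<alpha> \<otimes> \<delta>"
      using u(1) car zc by algebra
    finally have quad: "z \<otimes> z = (inv \<alpha> \<otimes> (\<gamma> \<ominus> \<beta>)) \<otimes> z \<oplus> inv \<alpha> \<otimes> \<delta>" .
    have "z [^] (card Fqn ^ 3) = z"
      using mem_Fq3n_iff[OF zc] zE by (simp add: card_Fqn power_mult[symmetric])
    then have "z \<in> Fqn"
      using quad u(3) ab cd Fqn_closed(4,6) frobenius_add[of _ _ n]
      by (intro quadratic_of_cubic_extension_in_subfield[OF Fqn finite_carrier _ zc, of _ "inv \<alpha> \<otimes> \<delta>"])
        (auto simp: card_Fqn)
    then show ?thesis using ab Fqn_closed(4,5) by simp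
  qed
  then have 1: "N n [^] (q ^ n) = N n" using mem_Fqn_iff Nc by blast
  have 2: "N n [^] (q ^ 3) = N n" using mem_Fq3_iff[OF Nc, of n] norm_in_Fq3 by (simp add: Nn)
  \<comment> \<open>The norm is fixed by the powers q^n and q^3, hence by q^1.\<close>
  have "coprime 3 n"
    using n_mod_3 by (intro prime_imp_coprime) (simp_all add: cong_0_iff)
  then have "gcd n 3 = 1" by (metis coprime_commute coprime_iff_gcd_eq_1)
  then have "N n \<in> Fq" using pow_power_fixed_gcd[OF Nc 1 2] mem_Fq_iff[OF Nc] by simp
  then show False using norm_a Nn by simp
qed

section \<open>Proportional vectors of U\<close>

lemma phi_coefficients_eqD:
  assumes "b \<in> Fq3n" "c \<in> Fq3n" "x \<in> Fq3n" "phi x = b \<oplus> c \<otimes> \<omega>"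
  shows "a \<otimes> x [^] (q ^ i) = b \<and> x = c"
  using assms a Fq3n_closed(4,9)
  by (intro subfield_coefficients_unique[OF Fq3n omega_carrier omega_notin_Fq3n]) (simp_all add: phi_def)

text \<open>With l = s + t omega, the two coordinates of \<open>phi y = l \<otimes> phi x\<close>
  both determine \<open>y\<close>. Eliminating \<open>y\<close> leaves one equation for
  \<open>z\<close>, which is of the excluded kind unless t = 0.\<close>

lemma phi_multiple:
  assumes x: "x \<in> Fq3n" "x \<noteq> \<zero>" and y: "y \<in> Fq3n" and l: "l \<in> Fq2n"
    and eq: "phi y = l \<otimes> phi x"
  obtains c where "c \<in> Fq" "y = c \<otimes> x"
proof -
  obtain s t where st: "s \<in> Fqn" "t \<in> Fqn" "l = s \<oplus> t \<otimes> \<omega>"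
    using Fq2n_coefficients[OF l] by blast
  have "\<omega> \<otimes> \<omega> \<in> Fq2n" using omega Fq2n_closed(4) by simp
  then obtain A B where AB: "A \<in> Fqn" "B \<in> Fqn" "\<omega> \<otimes> \<omega> = A \<oplus> B \<otimes> \<omega>"
    using Fq2n_coefficients by blast
  define S where "S = q ^ i"
  define z where "z = a \<otimes> x [^] S \<otimes> inv x"
  have xc: "x \<in> carrier F" and yc: "y \<in> carrier F" using x y Fq3n_closed(3) by auto
  have zE: "z \<in> Fq3n" using x a Fq3n_closed(4,8,9) by (simp add: z_def)
  then have zc: "z \<in> carrier F" by (rule Fq3n_closed(3))
  have zx: "z \<otimes> x = a \<otimes> x [^] S"
    using xc x(2) a_carrier field_Units by (simp add: z_def m_assoc)
  have xS: "x [^] S \<in> carrier F" "x [^] S \<noteq> \<zero>"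
    using nonzero_nat_pow_nonzero[OF xc x(2)] xc by simp_all
  then have "z \<otimes> x \<noteq> \<zero>"
    unfolding zx using a a_carrier by (simp add: integral_iff)
  then have "z \<noteq> \<zero>" using xc by auto
  \<comment> \<open>Reducing omega^2 to A + B omega adds t B x to the omega coordinate;
    \<open>e\<close> merges this with s x.\<close>
  define e where "e = s \<oplus> t \<otimes> B"
  have e: "e \<in> Fqn" using st AB Fqn_closed(4,5) by (simp add: e_def)
  have car: "s \<in> carrier F" "t \<in> carrier F" "A \<in> carrier F" "B \<in> carrier F" "e \<in> carrier F"
    using st AB e Fqn_closed(3) by auto
  have E: "s \<in> Fq3n" "t \<in> Fq3n" "A \<in> Fq3n" "e \<in> Fq3n"
    using st AB e Fqn_subset_Fq3n by auto
  have "phi y = (s \<oplus> t \<otimes> \<omega>) \<otimes> (z \<otimes> x \<oplus> x \<otimes> \<omega>)"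
    using eq st(3) zx by (simp add: phi_def S_def)
  also have "\<dots> = s \<otimes> z \<otimes> x \<oplus> (s \<otimes> x \<oplus> t \<otimes> z \<otimes> x) \<otimes> \<omega> \<oplus> t \<otimes> x \<otimes> (\<omega> \<otimes> \<omega>)"
    using car zc xc omega_carrier by algebra
  also have "\<dots> = (s \<otimes> z \<oplus> t \<otimes> A) \<otimes> x \<oplus> ((e \<oplus> t \<otimes> z) \<otimes> x) \<otimes> \<omega>"
    unfolding AB(3) e_def using car zc xc omega_carrier by algebra
  finally have "a \<otimes> y [^] S = (s \<otimes> z \<oplus> t \<otimes> A) \<otimes> x \<and> y = (e \<oplus> t \<otimes> z) \<otimes> x"
    unfolding S_def using E zE x y Fq3n_closed(4,5) by (intro phi_coefficients_eqD) simp_all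
  then have 1: "a \<otimes> y [^] S = (s \<otimes> z \<oplus> t \<otimes> A) \<otimes> x" and 2: "y = (e \<oplus> t \<otimes> z) \<otimes> x"
    by blast+
  have eS: "e [^] S \<in> Fqn" "t [^] S \<in> Fqn" using e st Fqn_closed(9) by simp_all
  have car': "e [^] S \<in> carrier F" "t [^] S \<in> carrier F" "z [^] S \<in> carrier F" "x [^] S \<in> carrier F"
    using car zc xc by simp_all
  \<comment> \<open>The omega coordinate is raised to the power \<open>S\<close> to be compared with
    the other coordinate, which contains \<open>y [^] S\<close>.\<close>
  have "y [^] S = (e [^] S \<oplus> t [^] S \<otimes> z [^] S) \<otimes> x [^] S"
    unfolding 2 S_def using car zc xc by (simp add: nat_pow_distrib frobenius_add)
  then have "a \<otimes> y [^] S = (e [^] S \<oplus> t [^] S \<otimes> z [^] S) \<otimes> (z \<otimes> x)"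
    unfolding zx using car' a_carrier by (simp add: m_ac)
  then have "((e [^] S \<oplus> t [^] S \<otimes> z [^] S) \<otimes> z) \<otimes> x = (s \<otimes> z \<oplus> t \<otimes> A) \<otimes> x"
    using 1 car' zc xc by (simp add: m_assoc)
  then have rel: "(e [^] S \<oplus> t [^] S \<otimes> z [^] S) \<otimes> z = s \<otimes> z \<oplus> t \<otimes> A"
    using m_rcancel xc x(2) car car' zc by simp
  have t0: "t = \<zero>"
  proof (rule ccontr)
    assume "t \<noteq> \<zero>"
    define u where "u = inv (t [^] S)"
    have tS: "t [^] S \<noteq> \<zero>" using nonzero_nat_pow_nonzero[OF car(2) \<open>t \<noteq> \<zero>\<close>] .
    then have u: "u \<in> carrier F" "u \<otimes> t [^] S = \<one>" "u \<in> Fqn"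
      using car' field_Units eS Fqn_closed(8) by (simp_all add: u_def)
    \<comment> \<open>Dividing \<open>rel\<close> by t^S isolates z z^S, with coefficients t A / t^S
      and (s - e^S) / t^S in \<open>Fqn\<close>.\<close>
    have "z \<otimes> z [^] S = (u \<otimes> t [^] S) \<otimes> (z \<otimes> z [^] S)" using u zc car' by simp
    also have "\<dots> = u \<otimes> ((e [^] S \<oplus> t [^] S \<otimes> z [^] S) \<otimes> z \<ominus> e [^] S \<otimes> z)"
      using u(1) zc car' by algebra
    also have "\<dots> = u \<otimes> t \<otimes> A \<oplus> (u \<otimes> (s \<ominus> e [^] S)) \<otimes> z"
      unfolding rel using u(1) zc car car' by algebra
    finally have "z \<otimes> z [^] S = u \<otimes> t \<otimes> A \<oplus> (u \<otimes> (s \<ominus> e [^] S)) \<otimes> z" .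
    moreover have "u \<otimes> t \<otimes> A \<in> Fqn" "u \<otimes> (s \<ominus> e [^] S) \<in> Fqn"
      using u st AB eS Fqn_closed(4,6) by simp_all
    ultimately show False
      using no_fractional_relation[OF x _ _ z_def[unfolded S_def]] unfolding S_def by blast
  qed
  have es: "e = s" using t0 car by (simp add: e_def)
  \<comment> \<open>Positivity of \<open>S\<close> makes t^S vanish together with \<open>t\<close>,
    so \<open>rel\<close> collapses to s^S z = s z.\<close>
  have "0 < S" using q_gt_1 by (simp add: S_def)
  then have "s [^] S \<otimes> z = s \<otimes> z"
    using rel t0 car car' zc by (simp add: es nat_pow_zero)
  then have "s [^] (q ^ i) = s"
    using m_rcancel[OF \<open>z \<noteq> \<zero>\<close> zc, of "s [^] S" s] car by (simp add: S_def)
  \<comment> \<open>Fixed by the powers q^i and q^n with \<open>i\<close> coprime to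
    \<open>n\<close>, the scalar \<open>s\<close> lies in \<open>Fq\<close>.\<close>
  moreover have "s [^] (q ^ n) = s" using mem_Fqn_iff car st by blast
  moreover have "gcd i n = 1" using coprime_i_n by simp
  ultimately have "s \<in> Fq" using pow_power_fixed_gcd[of s q i n] mem_Fq_iff car by simp
  moreover have "y = s \<otimes> x" using 2 t0 es car zc by simp
  ultimately show ?thesis by (rule that)
qed

section \<open>The linear set attached to U\<close>

lemma phi_closed: "x \<in> Fq3n \<Longrightarrow> phi x \<in> carrier F"
  using a_carrier omega_carrier Fq3n_closed(3) by (simp add: phi_def)

lemma phi_add: "x \<in> Fq3n \<Longrightarrow> y \<in> Fq3n \<Longrightarrow> phi (x \<oplus> y) = phi x \<oplus> phi y"
proof -
  assume "x \<in> Fq3n" "y \<in> Fq3n"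
  then have "x \<in> carrier F" "y \<in> carrier F" using Fq3n_closed(3) by auto
  then show ?thesis
    using a_carrier omega_carrier unfolding phi_def
    by (simp add: frobenius_add r_distr l_distr a_ac)
qed

lemma phi_scale: "c \<in> Fq \<Longrightarrow> x \<in> Fq3n \<Longrightarrow> phi (c \<otimes> x) = c \<otimes> phi x"
  using a_carrier omega_carrier Fq3n_closed(3)[of x] Fq_closed(3)[of c] Fq_power[of c i]
  by (simp add: phi_def nat_pow_distrib r_distr m_ac)

text \<open>The parameter is recovered as the omega coordinate.\<close>

lemma phi_inj: "inj_on phi Fq3n"
proof (rule inj_onI)
  fix x y assume "x \<in> Fq3n" "y \<in> Fq3n" "phi x = phi y"
  then show "x = y"
    using phi_coefficients_eqD[of "a \<otimes> y [^] (q ^ i)" y x] a Fq3n_closed(4,9) by (simp add: phi_def)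
qed

lemma phi_zero: "phi \<zero> = \<zero>"
  using phi_scale[OF Fq_closed(1) Fq3n_closed(1)] phi_closed[OF Fq3n_closed(1)] by simp

lemma phi_eq_zero_iff: "x \<in> Fq3n \<Longrightarrow> phi x = \<zero> \<longleftrightarrow> x = \<zero>"
  using inj_on_eq_iff[OF phi_inj, of x \<zero>] Fq3n_closed(1) by (simp add: phi_zero)

lemma subalgebra_range_phi: "subalgebra Fq (phi ` Fq3n) F"
proof (intro subalgebra.intro subalgebra_axioms.intro add.subgroupI)
  show "phi ` Fq3n \<subseteq> carrier F" using phi_closed by blast
  show "phi ` Fq3n \<noteq> {}" using Fq3n_closed(1) by blast
  show "u \<oplus> v \<in> phi ` Fq3n" if "u \<in> phi ` Fq3n" "v \<in> phi ` Fq3n" for u v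
    using that phi_add Fq3n_closed(5) by (auto simp flip: phi_add)
  show smult: "c \<otimes> v \<in> phi ` Fq3n" if "c \<in> Fq" "v \<in> phi ` Fq3n" for c v
    using that Fq3n_closed(4) Fq_subset_Fq3n by (auto simp flip: phi_scale)
  show "\<ominus> u \<in> phi ` Fq3n" if "u \<in> phi ` Fq3n" for u
  proof -
    have "u \<in> carrier F" using that phi_closed by blast
    then have "\<ominus> u = (\<ominus> \<one>) \<otimes> u" by (simp add: l_minus)
    then show ?thesis using smult[OF Fq_closed(7)[OF Fq_closed(2)] that] by simp
  qed
qed

lemma dimension_range_phi: "dimension (3 * n) Fq (phi ` Fq3n)"
  using subalgebra_range_phi
  by (intro dimension_if_card_eq[OF Fq finite_carrier])
    (simp_all add: card_image[OF phi_inj] card_Fq card_Fq3n)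

lemma dimension_carrier: "dimension 3 Fq2n (carrier F)"
  using order carrier_is_subalgebra[of Fq2n] Fq2n_closed(3)
  by (intro dimension_if_card_eq[OF Fq2n finite_carrier])
    (auto simp: order_def card_Fq2n simp flip: power_mult)

text \<open>\<open>phi\<close> vanishes only at zero, so nonzero vectors of \<open>U\<close>
  correspond to nonzero parameters.\<close>

lemma linear_set_range_phi: "linear_set Fq2n (phi ` Fq3n) = {Span Fq2n [phi x] | x. x \<in> Fq3n - {\<zero>}}"
  unfolding linear_set_def using phi_eq_zero_iff by blast

lemma linear_set_subset_points: "linear_set Fq2n (phi ` Fq3n) \<subseteq> pg_points Fq2n (carrier F)"
proof
  fix P assume "P \<in> linear_set Fq2n (phi ` Fq3n)"
  then obtain u where u: "u \<in> phi ` Fq3n" "u \<noteq> \<zero>" "P = Span Fq2n [u]"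
    unfolding linear_set_def by blast
  then have uc: "u \<in> carrier F" using phi_closed by blast
  then have "subalgebra Fq2n P F" using Span_is_subalgebra[OF Fq2n, of "[u]"] u(3) by simp
  then show "P \<in> pg_points Fq2n (carrier F)"
    unfolding pg_points_def
    using subalgebra_in_carrier dimension_Span_singleton[OF uc u(2)] u(3) by blast
qed

text \<open>By \<open>phi_multiple\<close>, \<open>U\<close> meets the point through
  \<open>phi x\<close> exactly in the \<open>Fq\<close>-span of \<open>phi x\<close>, which is a
  line over \<open>Fq\<close>.\<close>

lemma scattered_range_phi: "scattered Fq Fq2n (phi ` Fq3n)"
  unfolding scattered_def linear_set_range_phi
proof
  fix P assume "P \<in> {Span Fq2n [phi x] | x. x \<in> Fq3n - {\<zero>}}"
  then obtain x where x: "x \<in> Fq3n" "x \<noteq> \<zero>" and P: "P = Span Fq2n [phi x]" by blast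
  note c = phi_closed[OF x(1)]
  have "phi ` Fq3n \<inter> Span Fq2n [phi x] = Span Fq [phi x]"
  proof (intro equalityI subsetI)
    fix v assume "v \<in> phi ` Fq3n \<inter> Span Fq2n [phi x]"
    then obtain y l where yl: "y \<in> Fq3n" "v = phi y" "l \<in> Fq2n" "phi y = l \<otimes> phi x"
      using Span_singleton[OF Fq2n c] by auto
    obtain d where "d \<in> Fq" "y = d \<otimes> x" using phi_multiple[OF x yl(1,3,4)] .
    then show "v \<in> Span Fq [phi x]"
      using yl(2) x(1) unfolding Span_singleton[OF Fq c] by (auto simp: phi_scale)
  next
    fix v assume "v \<in> Span Fq [phi x]"
    then obtain d where d: "d \<in> Fq" "v = d \<otimes> phi x"
      unfolding Span_singleton[OF Fq c] by blast
    then have "v = phi (d \<otimes> x)" "d \<otimes> x \<in> Fq3n" "d \<in> Fq2n"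
      using x Fq3n_closed(4) Fq_subset_Fq3n Fq_subset_Fq2n by (simp_all add: phi_scale)
    then show "v \<in> phi ` Fq3n \<inter> Span Fq2n [phi x]"
      using d unfolding Span_singleton[OF Fq2n c] by blast
  qed
  then show "dimension 1 Fq (phi ` Fq3n \<inter> P)"
    unfolding P
    using dimension_Span_singleton[OF c] x phi_eq_zero_iff by simp
qed

end

theorem theorem2p3:
  fixes F (structure)
    and q n i :: nat
    and Fq Fqn Fq3 Fq2n Fq3n :: "'a set"
    and \<omega> a :: 'a
    and U :: "'a set" and L :: "'a set set"
  assumes "q \<ge> 2" and "primepow q"
    and "n > 0" and "\<not> [n = 0] (mod 3)"
    and "field F" and "order F = q ^ (6 * n)"
    and "subfield Fq F" and "card Fq = q"
    and "subfield Fqn F" and "card Fqn = q ^ n"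
    and "subfield Fq3 F" and "card Fq3 = q ^ 3"
    and "subfield Fq2n F" and "card Fq2n = q ^ (2 * n)"
    and "subfield Fq3n F" and "card Fq3n = q ^ (3 * n)"
    and "\<omega> \<in> Fq2n - Fqn"
    and "a \<in> Fq3n - {\<zero>}"
    and "1 \<le> i" and "i \<le> 3 * n - 1"
    and "gcd i (2 * n) = 1" and "gcd i (3 * n) = 3"
    and "cring.finite_field_norm F Fq3n Fq3 a \<notin> Fq"
    and "U = {a \<otimes> x [^] (q ^ i) \<oplus> x \<otimes> \<omega> | x. x \<in> Fq3n}"
    and "L = {ring.Span F Fq2n [a \<otimes> x [^] (q ^ i) \<oplus> x \<otimes> \<omega>] | x. x \<in> Fq3n - {\<zero>}}"
  shows "ring.dimension F 3 Fq2n (carrier F)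
    \<and> L \<subseteq> ring.pg_points F Fq2n (carrier F)
    \<and> subalgebra Fq U F \<and> ring.dimension F (3 * n) Fq U
    \<and> L = ring.linear_set F Fq2n U
    \<and> ring.scattered F Fq Fq2n U"
proof -
  interpret linear_set_setting F q n i Fq Fqn Fq3 Fq2n Fq3n \<omega> a
    using assms by (intro linear_set_setting.intro linear_set_setting_axioms.intro) simp_all
  have U: "U = phi ` Fq3n" using assms unfolding phi_def by blast
  have L: "L = linear_set Fq2n U"
    unfolding U linear_set_range_phi using assms unfolding phi_def by simp
  show ?thesis
    using dimension_carrier linear_set_subset_points subalgebra_range_phi dimension_range_phi
      scattered_range_phi L unfolding U by simp
qed

end
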